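(* The multilayer scheme described in the context preserves the steady states at rest: if at time $n$ there are constants $\Phi_1,\dots,\Phi_L$ such that $\mathbf u^n_{K,i}=0$ and $\Phi^n_{K,i}=\Phi_i$ for every cell $K\in\mathbb T$ and every layer $1\le i\le L$, then for every $K$ and $i$ one has $H^{n+1}_{K,i}=H^n_{K,i}$ (hence $\Phi^{n+1}_{K,i}=\Phi_i$) and $\mathbf u^{n+1}_{K,i}=0$.
   Context: Mesh. $\mathbb T$ is a tessellation of a domain $\Omega\subset\mathbb R^2$ by polygonal cells $K$, every edge $e\in\partial K$ being shared with exactly one neighbouring cell $K_e$. $m_K$ is the area of $K$, $m_{\partial K}$ its perimeter, $m_e$ the length of $e$, $\mathbf n_{e,K}$ the unit normal to $e$ outward from $K$ (pointing to $K_e$), $\mathbf x_K$ the mass center of $K$; in particular $\sum_{e\in\partial K}m_e\mathbf n_{e,K}=0$. Unknowns. $L\ge1$ layers; masses $H^n_{K,i}>0$, velocities $\mathbf u^n_{K,i}\in\mathbb R^2$; $\varepsilon>0$, $\Delta t>0$. Potentials $\Phi^n_{K,i}=\Phi_i(\boldsymbol H^n_K,\mathbf x_K)$ are given functions of the masses $\boldsymbol H_K^n=(H^n_{K,1},\dots,H^n_{K,L})$ and of position (e.g. $\Phi_i=g\big(z_b+\sum_{j}\frac{\rho_j}{\rho_{\max(i,j)}}h_j\big)$, $H_j=\rho_jh_j$, for the multilayer shallow water model with bottom topography $z_b$ and layer densities $\rho_j$). Edge notation. For piecewise constant scalar $w$: $\overline w_e=\frac12(w_{K_e}+w_K)$,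 $\boldsymbol\delta w_e=\frac12(w_{K_e}-w_K)\mathbf n_{e,K}$. For piecewise constant vector $\mathbf w$: $\overline{\mathbf w}_e=\frac12(\mathbf w_{K_e}+\mathbf w_K)$, $\delta\mathbf w_e=\frac12(\mathbf w_{K_e}-\mathbf w_K)\cdot\mathbf n_{e,K}$. $w^\pm=\frac12(w\pm|w|)$. Scheme. For all $K$ and $i$, $$H^{n+1}_{K,i}=H^n_{K,i}-\frac{\Delta t}{m_K}\sum_{e\in\partial K}(\mathcal F^n_{e,i}\cdot\mathbf n_{e,K})m_e,$$ $$H^{n+1}_{K,i}\mathbf u^{n+1}_{K,i}=H^n_{K,i}\mathbf u^n_{K,i}-\frac{\Delta t}{m_K}\sum_{e\in\partial K}\Big(\mathbf u^n_{K,i}(\mathcal F^n_{e,i}\cdot\mathbf n_{e,K})^++\mathbf u^n_{K_e,i}(\mathcal F^n_{e,i}\cdot\mathbf n_{e,K})^-\Big)m_e-\frac{\Delta t}{m_K}H^n_{K,i}\sum_{e\in\partial K}\frac{\Phi^{n,\ast}_{e,i}}{\varepsilon^2}\mathbf n_{e,K}m_e,$$ with $$\mathcal F^n_{e,i}=\overline{H\mathbf u}^n_{e,i}-\Pi^n_{e,i},\quad \Pi^n_{e,i}=\gamma\Delta t\Big(\frac{\widehat H}{\Delta}\Big)^n_{e,i}\frac{\boldsymbol\delta\Phi^n_{e,i}}{\varepsilon^2},\qquad \Phi^{n,\ast}_{e,i}=\overline\Phi^n_{e,i}-\Lambda^n_{e,i},\quad \Lambda^n_{e,i}=\alpha\Delta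 t\frac{C_{\mathcal H}}{\Delta_e}\delta(H\mathbf u)^n_{e,i},$$ where $\gamma,\alpha\ge0$ and $C_{\mathcal H}$ are constants, and $$\frac1{\Delta_e}=\frac12\Big(\frac{m_{\partial K}}{m_K}+\frac{m_{\partial K_e}}{m_{K_e}}\Big),\qquad \Big(\frac{\widehat H}{\Delta}\Big)^n_{e,i}=\frac12\Big(\widehat H^n_{K,i}\frac{m_{\partial K}}{2m_K}+\widehat H^n_{K_e,i}\frac{m_{\partial K_e}}{2m_{K_e}}\Big),$$ with $\widehat H^n_{K,i}$ a nonnegative weight (equal to $H^n_{K,i}$ in practice, or $(H^n_{K,i})^2/H^{n+1}_{K,i}$ in the nonlinear stability analysis; either choice is allowed). *)

theory Defs
  imports "HOL-Analysis.Analysis"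
begin

section \<open>Polygonal meshes\<close>

type_synonym point = "real ^ 2"

text \<open>
  The edges of a cell are part of the mesh, not determined by the cell as a set: a side of a
  polygon is split into several edges (with collinear vertices between them) when it is shared
  with several neighbours.
\<close>

record mesh =
  cells :: "point set set"
  cell_edges :: "point set \<Rightarrow> point set set"

text \<open>
  Closed simple polygons, not necessarily convex. Connectedness of the interior and of the
  complement excludes self-contact and holes; the pairwise condition says that distinct edges
  meet at most at common endpoints.
\<close>

definition polygonal_cell :: "point set \<Rightarrow> point set set \<Rightarrow> bool" where
  "polygonal_cell K E \<longleftrightarrow>
     compact K \<and> interior K \<noteq> {} \<and> closure (interior K) = K \<and>
     connected (interior K) \<and> connected (- K) \<and>
     finite E \<and> (\<forall>e\<in>E. \<exists>a b. a \<noteq> b \<and> e = closed_segment a b) \<and>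
     pairwise (\<lambda>e e'. rel_interior e \<inter> e' = {}) E \<and>
     frontier K = \<Union>E"

text \<open>
  The set of cells may be infinite. Since every edge is shared by two cells, there are no
  boundary edges; a periodic mesh is represented by its periodic lift to the plane.
  The cells are closed sets, whence the two inclusions instead of an equality with the open
  set \<open>\<Omega>\<close>.
\<close>

definition tessellation :: "point set \<Rightarrow> mesh \<Rightarrow> bool" where
  "tessellation \<Omega> M \<longleftrightarrow>
     open \<Omega> \<and> connected \<Omega> \<and> \<Omega> \<noteq> {} \<and>
     (\<forall>K\<in>cells M. polygonal_cell K (cell_edges M K)) \<and>
     pairwise (\<lambda>K K'. interior K \<inter> interior K' = {}) (cells M) \<and>
     \<Omega> \<subseteq> \<Union>(cells M) \<and> \<Union>(cells M) \<subseteq> closure \<Omega> \<and>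
     (\<forall>K\<in>cells M. \<forall>e\<in>cell_edges M K.
        \<exists>!K'. K' \<in> cells M \<and> K' \<noteq> K \<and> e \<in> cell_edges M K')"

definition neighbour :: "mesh \<Rightarrow> point set \<Rightarrow> point set \<Rightarrow> point set" where
  "neighbour M K e = (THE K'. K' \<in> cells M \<and> K' \<noteq> K \<and> e \<in> cell_edges M K')"

definition area :: "point set \<Rightarrow> real" where
  "area K = measure lebesgue K"

text \<open>An edge is a segment, so its length is its diameter.\<close>

definition edge_length :: "point set \<Rightarrow> real" where
  "edge_length e = diameter e"

definition perimeter :: "mesh \<Rightarrow> point set \<Rightarrow> real" where
  "perimeter M K = (\<Sum>e\<in>cell_edges M K. edge_length e)"

definition mass_center :: "point set \<Rightarrow> point" where
  "mass_center K = (1 / area K) *\<^sub>R integral K (\<lambda>x. x)"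

text \<open>
  The unit vector orthogonal to \<open>e\<close> along which one leaves \<open>K\<close> when starting from any point
  of \<open>e\<close> that is not an endpoint.
\<close>

definition outward_normal :: "point set \<Rightarrow> point set \<Rightarrow> point" where
  "outward_normal K e = (THE \<nu>. norm \<nu> = 1 \<and>
     (\<forall>x\<in>e. \<forall>y\<in>e. \<nu> \<bullet> (x - y) = 0) \<and>
     (\<forall>x\<in>rel_interior e. \<forall>\<^sub>F t in at_right 0. x + t *\<^sub>R \<nu> \<notin> K))"


section \<open>Discrete operators at the edges\<close>

text \<open>
  All edge quantities are written as seen from a cell \<open>K\<close> to which the edge \<open>e\<close> belongs.
  The mean applies to scalar and to vector fields, \<open>edge_jump\<close> to scalar and
  \<open>edge_normal_jump\<close> to vector fields.
\<close>

definition edge_mean ::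
  "mesh \<Rightarrow> (point set \<Rightarrow> 'v::real_vector) \<Rightarrow> point set \<Rightarrow> point set \<Rightarrow> 'v" where
  "edge_mean M w K e = (1/2) *\<^sub>R (w (neighbour M K e) + w K)"

definition edge_jump ::
  "mesh \<Rightarrow> (point set \<Rightarrow> real) \<Rightarrow> point set \<Rightarrow> point set \<Rightarrow> point" where
  "edge_jump M w K e = (1/2 * (w (neighbour M K e) - w K)) *\<^sub>R outward_normal K e"

definition edge_normal_jump ::
  "mesh \<Rightarrow> (point set \<Rightarrow> point) \<Rightarrow> point set \<Rightarrow> point set \<Rightarrow> real" where
  "edge_normal_jump M w K e =
     ((1/2) *\<^sub>R (w (neighbour M K e) - w K)) \<bullet> outward_normal K e"

definition pos_part :: "real \<Rightarrow> real" where
  "pos_part w = (w + \<bar>w\<bar>) / 2"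

definition neg_part :: "real \<Rightarrow> real" where
  "neg_part w = (w - \<bar>w\<bar>) / 2"

definition inv_Delta :: "mesh \<Rightarrow> point set \<Rightarrow> point set \<Rightarrow> real" where
  "inv_Delta M K e = 1/2 * (perimeter M K / area K
     + perimeter M (neighbour M K e) / area (neighbour M K e))"


section \<open>The multilayer scheme\<close>

text \<open>
  Layers are indexed by a finite type \<open>'l\<close>. At each time, the masses are a map from cells to
  \<open>real ^ 'l\<close>, and the velocities a map from cells to \<open>point ^ 'l\<close>.
  The field \<open>potential\<close> is the given function \<open>\<Phi>\<^sub>i(H, x)\<close> of the layer, of the masses
  of all layers and of the position.
\<close>

record 'l params =
  epsilon :: real
  dt :: real
  gamma :: real
  alpha :: real
  CH :: real
  potential :: "'l \<Rightarrow> real ^ 'l \<Rightarrow> point \<Rightarrow> real"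

definition Phi ::
  "'l::finite params \<Rightarrow> (point set \<Rightarrow> real ^ 'l) \<Rightarrow> 'l \<Rightarrow> point set \<Rightarrow> real" where
  "Phi P H i K = potential P i (H K) (mass_center K)"

definition momentum ::
  "(point set \<Rightarrow> real ^ 'l::finite) \<Rightarrow> (point set \<Rightarrow> point ^ 'l) \<Rightarrow> 'l \<Rightarrow> point set \<Rightarrow> point" where
  "momentum H u i K = (H K $ i) *\<^sub>R (u K $ i)"

definition weight_over_Delta ::
  "mesh \<Rightarrow> (point set \<Rightarrow> real ^ 'l::finite) \<Rightarrow> 'l \<Rightarrow> point set \<Rightarrow> point set \<Rightarrow> real" where
  "weight_over_Delta M Hhat i K e =
     1/2 * (Hhat K $ i * (perimeter M K / (2 * area K))
       + Hhat (neighbour M K e) $ i *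
           (perimeter M (neighbour M K e) / (2 * area (neighbour M K e))))"

definition Pi_edge ::
  "mesh \<Rightarrow> 'l::finite params \<Rightarrow> (point set \<Rightarrow> real ^ 'l) \<Rightarrow> (point set \<Rightarrow> real ^ 'l) \<Rightarrow>
   'l \<Rightarrow> point set \<Rightarrow> point set \<Rightarrow> point" where
  "Pi_edge M P Hhat H i K e =
     (gamma P * dt P * weight_over_Delta M Hhat i K e / (epsilon P)\<^sup>2) *\<^sub>R
       edge_jump M (Phi P H i) K e"

definition flux ::
  "mesh \<Rightarrow> 'l::finite params \<Rightarrow> (point set \<Rightarrow> real ^ 'l) \<Rightarrow> (point set \<Rightarrow> real ^ 'l) \<Rightarrow>
   (point set \<Rightarrow> point ^ 'l) \<Rightarrow> 'l \<Rightarrow> point set \<Rightarrow> point set \<Rightarrow> point" where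
  "flux M P Hhat H u i K e = edge_mean M (momentum H u i) K e - Pi_edge M P Hhat H i K e"

definition Lambda_edge ::
  "mesh \<Rightarrow> 'l::finite params \<Rightarrow> (point set \<Rightarrow> real ^ 'l) \<Rightarrow>
   (point set \<Rightarrow> point ^ 'l) \<Rightarrow> 'l \<Rightarrow> point set \<Rightarrow> point set \<Rightarrow> real" where
  "Lambda_edge M P H u i K e =
     alpha P * dt P * (CH P * inv_Delta M K e) * edge_normal_jump M (momentum H u i) K e"

definition Phi_star ::
  "mesh \<Rightarrow> 'l::finite params \<Rightarrow> (point set \<Rightarrow> real ^ 'l) \<Rightarrow>
   (point set \<Rightarrow> point ^ 'l) \<Rightarrow> 'l \<Rightarrow> point set \<Rightarrow> point set \<Rightarrow> real" where
  "Phi_star M P H u i K e = edge_mean M (Phi P H i) K e - Lambda_edge M P H u i K e"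

text \<open>
  One time step from the state \<open>(H, u)\<close> to \<open>(H', u')\<close>, with \<open>Hhat\<close> the weight entering the
  stabilisation of the mass flux.
\<close>

definition scheme_step ::
  "mesh \<Rightarrow> 'l::finite params \<Rightarrow> (point set \<Rightarrow> real ^ 'l) \<Rightarrow>
   (point set \<Rightarrow> real ^ 'l) \<Rightarrow> (point set \<Rightarrow> point ^ 'l) \<Rightarrow>
   (point set \<Rightarrow> real ^ 'l) \<Rightarrow> (point set \<Rightarrow> point ^ 'l) \<Rightarrow> bool" where
  "scheme_step M P Hhat H u H' u' \<longleftrightarrow> (\<forall>K\<in>cells M. \<forall>i.
     H' K $ i = H K $ i - dt P / area K *
       (\<Sum>e\<in>cell_edges M K.
          (flux M P Hhat H u i K e \<bullet> outward_normal K e) * edge_length e) \<and>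
     (H' K $ i) *\<^sub>R (u' K $ i) = (H K $ i) *\<^sub>R (u K $ i)
       - (dt P / area K) *\<^sub>R
           (\<Sum>e\<in>cell_edges M K. edge_length e *\<^sub>R
              (pos_part (flux M P Hhat H u i K e \<bullet> outward_normal K e) *\<^sub>R (u K $ i)
               + neg_part (flux M P Hhat H u i K e \<bullet> outward_normal K e) *\<^sub>R
                   (u (neighbour M K e) $ i)))
       - (dt P / area K * H K $ i) *\<^sub>R
           (\<Sum>e\<in>cell_edges M K.
              (Phi_star M P H u i K e / (epsilon P)\<^sup>2 * edge_length e) *\<^sub>R outward_normal K e))"

end

theory Submission
  imports Defs
begin

text \<open>
  At rest the momentum vanishes and the potential has no jumps, so the fluxes vanish and the
  starred potential is constant; the claim reduces to the closure of the boundary,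
  \<open>\<Sum>\<^sub>e m\<^sub>e n\<^sub>e\<^sub>,\<^sub>K = 0\<close>. For a unit vector \<open>d\<close>, the number \<open>m\<^sub>e (n\<^sub>e\<^sub>,\<^sub>K \<bullet> d)\<close> is, up to the sign of
  \<open>n\<^sub>e\<^sub>,\<^sub>K \<bullet> d\<close>, the length of the projection of \<open>e\<close> along \<open>d\<close>. A line in direction \<open>d\<close> that avoids
  the vertices leaves the bounded set \<open>K\<close> as often as it enters it, so the signs of the edges that
  it crosses add up to \<open>0\<close>; integrating over the parallel lines gives
  \<open>\<Sum>\<^sub>e m\<^sub>e (n\<^sub>e\<^sub>,\<^sub>K \<bullet> d) = 0\<close>.
\<close>


section \<open>The quarter turn of the plane, and the length of a segment\<close>

definition rot :: "point \<Rightarrow> point" where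
  "rot x = vector [- x $ 2, x $ 1]"

lemma inner_point: "(x::point) \<bullet> y = x $ 1 * y $ 1 + x $ 2 * y $ 2"
  by (simp add: inner_vec_def sum_2)

lemma rot_nth [simp]: "rot x $ 1 = - x $ 2" "rot x $ 2 = x $ 1"
  by (simp_all add: rot_def vector_2)

lemma inner_rot_self [simp]: "rot x \<bullet> x = 0" "x \<bullet> rot x = 0"
  by (simp_all add: inner_point)

lemma inner_rot_rot [simp]: "rot x \<bullet> rot y = x \<bullet> y"
  by (simp add: inner_point)

lemma norm_rot [simp]: "norm (rot x) = norm x"
  by (simp add: norm_eq_sqrt_inner)

text \<open>For a unit vector d, \<open>rot d\<close> and d form an orthonormal frame:
  \<open>x \<bullet> rot d\<close> tells on which line in direction d the point x lies, and
  \<open>x \<bullet> d\<close> where on that line.\<close>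

lemma rot_decomp:
  assumes "norm d = 1"
  shows "x = (x \<bullet> rot d) *\<^sub>R rot d + (x \<bullet> d) *\<^sub>R d"
proof -
  have "d $ 1 * d $ 1 + d $ 2 * d $ 2 = 1"
    using assms by (metis inner_point norm_eq_1)
  then have "x $ 1 = (x \<bullet> rot d) * - d $ 2 + (x \<bullet> d) * d $ 1"
    "x $ 2 = (x \<bullet> rot d) * d $ 1 + (x \<bullet> d) * d $ 2"
    unfolding inner_point rot_nth by algebra+
  then show ?thesis
    by (simp add: vec_eq_iff forall_2)
qed

text \<open>Makes \<open>edge_length\<close>, defined as a diameter, computable: points with
  parameters s and t differ by \<open>(s - t) *\<^sub>R (b - a)\<close>, and the endpoints attain
  the bound.\<close>

lemma diameter_closed_segment:
  fixes a b :: "'a::real_normed_vector"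
  shows "diameter (closed_segment a b) = norm (b - a)"
proof (rule antisym)
  show "diameter (closed_segment a b) \<le> norm (b - a)"
  proof (rule diameter_le)
    fix x y assume "x \<in> closed_segment a b" "y \<in> closed_segment a b"
    then obtain s t where st: "x = (1 - s) *\<^sub>R a + s *\<^sub>R b" "y = (1 - t) *\<^sub>R a + t *\<^sub>R b"
        "0 \<le> s" "s \<le> 1" "0 \<le> t" "t \<le> 1"
      by (auto simp: in_segment)
    have "x - y = (s - t) *\<^sub>R (b - a)"
      unfolding st by (simp add: algebra_simps)
    moreover have "\<bar>s - t\<bar> \<le> 1"
      using st by linarith
    ultimately show "norm (x - y) \<le> norm (b - a)"
      by (simp add: mult_left_le_one_le)
  qed simp
  show "norm (b - a) \<le> diameter (closed_segment a b)"
    using diameter_bounded_bound[of "closed_segment a b" b a]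
    by (simp add: dist_norm bounded_closed_segment)
qed

section \<open>The outward normal\<close>

text \<open>Stronger at x than the ray condition in \<open>outward_normal\<close>: both half discs
  are decided, so every direction transversal to the edge can be followed, as the crossing argument
  requires. Points on the line through x orthogonal to \<nu> are left open.\<close>

definition exits_along :: "point set \<Rightarrow> point \<Rightarrow> point \<Rightarrow> bool" where
  "exits_along K \<nu> x \<longleftrightarrow> (\<exists>r>0. \<forall>y\<in>ball x r.
     ((y - x) \<bullet> \<nu> > 0 \<longrightarrow> y \<notin> K) \<and> ((y - x) \<bullet> \<nu> < 0 \<longrightarrow> y \<in> K))"

lemma exits_along_eventually:
  assumes "exits_along K \<nu> x"
  shows "v \<bullet> \<nu> > 0 \<Longrightarrow> \<forall>\<^sub>F t in at_right 0. x + t *\<^sub>R v \<notin> K"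
    and "v \<bullet> \<nu> < 0 \<Longrightarrow> \<forall>\<^sub>F t in at_right 0. x + t *\<^sub>R v \<in> K"
proof -
  obtain r where r: "r > 0" "\<And>y. y \<in> ball x r \<Longrightarrow>
      ((y - x) \<bullet> \<nu> > 0 \<longrightarrow> y \<notin> K) \<and> ((y - x) \<bullet> \<nu> < 0 \<longrightarrow> y \<in> K)"
    using assms unfolding exits_along_def by blast
  have "((\<lambda>t. x + t *\<^sub>R v) \<longlongrightarrow> x + 0 *\<^sub>R v) (at_right 0)"
    by (intro tendsto_intros)
  then have "\<forall>\<^sub>F t in at_right 0. x + t *\<^sub>R v \<in> ball x r"
    using r(1) by (intro topological_tendstoD) auto
  moreover have "\<forall>\<^sub>F t in at_right (0::real). t > 0"
    by (rule eventually_at_right_less)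
  ultimately have *: "\<forall>\<^sub>F t in at_right 0. t > 0 \<and> x + t *\<^sub>R v \<in> ball x r"
    by eventually_elim simp
  show "\<forall>\<^sub>F t in at_right 0. x + t *\<^sub>R v \<notin> K" if "v \<bullet> \<nu> > 0"
    using * r(2) that by (auto elim!: eventually_mono simp: zero_less_mult_iff)
  show "\<forall>\<^sub>F t in at_right 0. x + t *\<^sub>R v \<in> K" if "v \<bullet> \<nu> < 0"
    using * r(2) that by (auto elim!: eventually_mono simp: mult_less_0_iff)
qed

text \<open>Each open half disc is convex and misses the frontier, hence lies in K or outside K. The
  two cannot agree: x is a frontier point of the closure of an open set, so both the interior and
  the complement of K come arbitrarily close to x.\<close>

lemma exits_along_dichotomy:
  assumes K: "closure (interior K) = K" and x: "x \<in> frontier K" and "\<nu> \<noteq> 0" "r > 0"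
    and off: "\<And>y. y \<in> ball x r \<Longrightarrow> (y - x) \<bullet> \<nu> \<noteq> 0 \<Longrightarrow> y \<notin> frontier K"
  shows "exits_along K \<nu> x \<or> exits_along K (- \<nu>) x"
proof -
  define S where "S \<mu> = {y \<in> ball x r. (y - x) \<bullet> \<mu> > 0}" for \<mu>
  have S: "S \<mu> \<subseteq> K \<or> S \<mu> \<inter> K = {}" if "\<mu> = \<nu> \<or> \<mu> = - \<nu>" for \<mu>
  proof -
    have "S \<mu> = ball x r \<inter> {y. \<mu> \<bullet> y > \<mu> \<bullet> x}"
      by (auto simp: S_def inner_diff_right inner_commute[of _ \<mu>])
    then have "connected (S \<mu>)"
      by (simp add: convex_connected convex_Int convex_halfspace_gt)
    moreover have "y \<notin> frontier K" if "y \<in> S \<mu>" for y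
      using off[of y] that \<open>\<mu> = \<nu> \<or> \<mu> = - \<nu>\<close> by (auto simp: S_def)
    ultimately show ?thesis
      using connected_Int_frontier[of "S \<mu>" K] by blast
  qed
  have hit: "\<exists>y\<in>U. y \<in> S \<nu> \<union> S (- \<nu>)" if U: "open U" "U \<noteq> {}" "U \<subseteq> ball x r" for U
  proof -
    obtain z where z: "z \<in> U" using U(2) by blast
    then obtain \<delta> where \<delta>: "\<delta> > 0" "ball z \<delta> \<subseteq> U"
      using U(1) open_contains_ball by blast
    \<comment> \<open>The line through x orthogonal to \<nu> has no interior: a shift of length
      \<open>\<delta> / 2\<close> along \<nu> stays in U and changes the inner product with \<nu>,
      so z or w is off the line.\<close>
    define w where "w = z + (\<delta> / (2 * norm \<nu>)) *\<^sub>R \<nu>"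
    have "w \<in> U"
      using \<delta> \<open>\<nu> \<noteq> 0\<close> by (auto simp: w_def dist_norm intro!: subsetD[OF \<delta>(2)])
    moreover have "(w - x) \<bullet> \<nu> \<noteq> (z - x) \<bullet> \<nu>"
      using \<delta> \<open>\<nu> \<noteq> 0\<close> by (simp add: w_def inner_add_left inner_diff_left)
    ultimately obtain y where "y \<in> U" "(y - x) \<bullet> \<nu> \<noteq> 0"
      using z by metis
    then show ?thesis
      using U(3) by (intro bexI[of _ y]) (auto simp: S_def)
  qed
  have "closed K" using K closed_closure by metis
  then have "x \<in> K"
    using x frontier_subset_closed by blast
  then have xc: "x \<in> closure (interior K)" "x \<in> closure (- K)"
    using x unfolding K by (simp_all add: frontier_closures)
  have "\<not> (S \<nu> \<union> S (- \<nu>) \<subseteq> K)"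
  proof -
    have "ball x r \<inter> - K \<noteq> {}"
      using xc(2) \<open>r > 0\<close> open_Int_closure_eq_empty[of "ball x r" "- K"]
        centre_in_ball[of x r] open_ball by blast
    then show ?thesis
      using hit[of "ball x r \<inter> - K"] \<open>closed K\<close> by (auto simp: open_Compl)
  qed
  moreover have "\<not> ((S \<nu> \<union> S (- \<nu>)) \<inter> K = {})"
  proof -
    have "ball x r \<inter> interior K \<noteq> {}"
      using xc(1) \<open>r > 0\<close> open_Int_closure_eq_empty[of "ball x r" "interior K"]
        centre_in_ball[of x r] open_ball by blast
    then show ?thesis
      using hit[of "ball x r \<inter> interior K"] interior_subset[of K] by blast
  qed
  ultimately have "(S \<nu> \<inter> K = {} \<and> S (- \<nu>) \<subseteq> K) \<or> (S (- \<nu>) \<inter> K = {} \<and> S \<nu> \<subseteq> K)"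
    using S by blast
  then show ?thesis
  proof
    assume "S \<nu> \<inter> K = {} \<and> S (- \<nu>) \<subseteq> K"
    then have "exits_along K \<nu> x"
      unfolding exits_along_def using \<open>r > 0\<close> by (intro exI[of _ r]) (auto simp: S_def)
    then show ?thesis ..
  next
    assume "S (- \<nu>) \<inter> K = {} \<and> S \<nu> \<subseteq> K"
    then have "exits_along K (- \<nu>) x"
      unfolding exits_along_def using \<open>r > 0\<close> by (intro exI[of _ r]) (auto simp: S_def)
    then show ?thesis ..
  qed
qed

text \<open>Otherwise the ray from x along \<nu> would start both outside and inside K.\<close>

lemma not_exits_along_uminus:
  assumes "\<nu> \<noteq> 0" "exits_along K \<nu> x"
  shows "\<not> exits_along K (- \<nu>) x"
proof
  assume "exits_along K (- \<nu>) x"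
  then have "\<forall>\<^sub>F t in at_right 0. x + t *\<^sub>R \<nu> \<in> K"
    using assms by (intro exits_along_eventually(2)[where \<nu> = "- \<nu>"]) auto
  moreover have "\<forall>\<^sub>F t in at_right 0. x + t *\<^sub>R \<nu> \<notin> K"
    using assms by (intro exits_along_eventually(1)[OF assms(2)]) auto
  ultimately have "\<forall>\<^sub>F t in at_right (0::real). False"
    by eventually_elim simp
  then show False by simp
qed

text \<open>By flatness all points of S see the same two half planes, so each alternative in
  \<open>dich\<close> is an open condition on S. The alternatives exclude each other, and S is
  connected.\<close>

lemma exits_along_propagates:
  assumes "connected S" "x \<in> S" "y \<in> S" "exits_along K \<nu> x"
    and flat: "\<And>y z. y \<in> S \<Longrightarrow> z \<in> S \<Longrightarrow> (y - z) \<bullet> \<nu> = 0"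
    and dich: "\<And>z. z \<in> S \<Longrightarrow> exits_along K \<nu> z \<or> exits_along K (- \<nu>) z" and "\<nu> \<noteq> 0"
  shows "exits_along K \<nu> y"
proof -
  have near: "\<exists>T. openin (top_of_set S) T \<and> z \<in> T \<and> (\<forall>w\<in>T. exits_along K \<mu> w)"
    if "z \<in> S" "exits_along K \<mu> z" "\<mu> = \<nu> \<or> \<mu> = - \<nu>" for \<mu> z
  proof -
    obtain r where r: "r > 0" "\<And>y. y \<in> ball z r \<Longrightarrow>
        ((y - z) \<bullet> \<mu> > 0 \<longrightarrow> y \<notin> K) \<and> ((y - z) \<bullet> \<mu> < 0 \<longrightarrow> y \<in> K)"
      using \<open>exits_along K \<mu> z\<close> unfolding exits_along_def by blast
    have "exits_along K \<mu> w" if w: "w \<in> S \<inter> ball z r" for w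
      unfolding exits_along_def
    proof (intro exI[of _ "r - dist z w"] conjI ballI)
      show "r - dist z w > 0" using w by simp
      fix y assume "y \<in> ball w (r - dist z w)"
      then have "y \<in> ball z r"
        using dist_triangle[of z y w] by simp
      moreover have "(y - w) \<bullet> \<mu> = (y - z) \<bullet> \<mu>"
        using flat[of w z] w \<open>z \<in> S\<close> \<open>\<mu> = \<nu> \<or> \<mu> = - \<nu>\<close> by (auto simp: inner_diff_left)
      ultimately show "(y - w) \<bullet> \<mu> > 0 \<longrightarrow> y \<notin> K" "(y - w) \<bullet> \<mu> < 0 \<longrightarrow> y \<in> K"
        using r(2) by auto
    qed
    then show ?thesis
      using \<open>z \<in> S\<close> r(1) by (intro exI[of _ "S \<inter> ball z r"]) auto
  qed
  show ?thesis
  proof (rule connected_induction_simple[where P = "exits_along K \<nu>", OF assms(1-4)])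
    fix z assume z: "z \<in> S"
    consider "exits_along K \<nu> z" | "exits_along K (- \<nu>) z"
      using dich z by blast
    then show "\<exists>T. openin (top_of_set S) T \<and> z \<in> T \<and>
        (\<forall>x\<in>T. \<forall>y\<in>T. exits_along K \<nu> x \<longrightarrow> exits_along K \<nu> y)"
    proof cases
      case 1
      then obtain T where "openin (top_of_set S) T" "z \<in> T" "\<forall>w\<in>T. exits_along K \<nu> w"
        using near[OF z] by metis
      then show ?thesis by metis
    next
      case 2
      then obtain T where "openin (top_of_set S) T" "z \<in> T" "\<forall>w\<in>T. exits_along K (- \<nu>) w"
        using near[OF z] by metis
      then show ?thesis using not_exits_along_uminus[OF \<open>\<nu> \<noteq> 0\<close>] by metis
    qed
  qed
qed

text \<open>The other edges form a closed set that misses x, so near x the frontier lies in e, hence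
  on the line through x orthogonal to \<nu>.\<close>

lemma edge_exits_along_dichotomy:
  assumes cell: "polygonal_cell K E" and e: "e \<in> E" and x: "x \<in> rel_interior e"
    and "\<nu> \<noteq> 0" and flat: "\<And>y z. y \<in> e \<Longrightarrow> z \<in> e \<Longrightarrow> (y - z) \<bullet> \<nu> = 0"
  shows "exits_along K \<nu> x \<or> exits_along K (- \<nu>) x"
proof -
  have E: "finite E" "\<And>e. e \<in> E \<Longrightarrow> \<exists>a b. a \<noteq> b \<and> e = closed_segment a b"
      "pairwise (\<lambda>e e'. rel_interior e \<inter> e' = {}) E" "frontier K = \<Union>E"
      "closure (interior K) = K"
    using cell unfolding polygonal_cell_def by auto
  have "closed (\<Union>(E - {e}))"
    using E(1,2) by (intro closed_Union) (auto dest!: E(2))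
  moreover have "x \<notin> \<Union>(E - {e})"
    using E(3) e x unfolding pairwise_def by blast
  ultimately obtain r where r: "r > 0" "ball x r \<inter> \<Union>(E - {e}) = {}"
    by (metis ComplI Compl_disjoint disjoint_eq_subset_Compl open_Compl open_contains_ball)
  have xe: "x \<in> e" using x rel_interior_subset by blast
  show ?thesis
  proof (rule exits_along_dichotomy[OF E(5) _ \<open>\<nu> \<noteq> 0\<close> r(1)])
    show "x \<in> frontier K" using xe e E(4) by blast
    show "y \<notin> frontier K" if "y \<in> ball x r" "(y - x) \<bullet> \<nu> \<noteq> 0" for y
      using that r(2) flat[of y x] xe E(4) by blast
  qed
qed

text \<open>Turns the definite description into usable facts. Orthogonality to e leaves two opposite
  unit vectors; the dichotomy at one point m selects one of them, and connectedness of the relative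
  interior carries the choice along e.\<close>

lemma outward_normal_props:
  assumes cell: "polygonal_cell K E" and e: "e \<in> E"
  shows "norm (outward_normal K e) = 1"
    and "\<And>x y. x \<in> e \<Longrightarrow> y \<in> e \<Longrightarrow> outward_normal K e \<bullet> (x - y) = 0"
    and "\<And>x. x \<in> rel_interior e \<Longrightarrow> exits_along K (outward_normal K e) x"
proof -
  have "\<forall>e\<in>E. \<exists>a b. a \<noteq> b \<and> e = closed_segment a b"
    using cell unfolding polygonal_cell_def by auto
  then obtain a b where ab: "a \<noteq> b" "e = closed_segment a b"
    using e by blast
  define d where "d = (1 / norm (b - a)) *\<^sub>R (b - a)"
  have d: "norm d = 1" "b - a = norm (b - a) *\<^sub>R d"
    using ab by (auto simp: d_def)
  \<comment> \<open>The midpoint shows that the relative interior is nonempty.\<close>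
  have "a + (1/2) *\<^sub>R (b - a) \<in> open_segment a b"
    using ab(1) by (auto simp: in_segment algebra_simps intro!: exI[of _ "1/2"])
  then obtain m where m: "m \<in> rel_interior e"
    using ab by (auto simp: rel_interior_closed_segment)
  have diff: "\<exists>t. y - z = t *\<^sub>R d" if yz: "y \<in> e" "z \<in> e" for y z
  proof -
    obtain s t where st: "y = (1 - s) *\<^sub>R a + s *\<^sub>R b" "z = (1 - t) *\<^sub>R a + t *\<^sub>R b"
      using yz by (auto simp: ab in_segment)
    have "y - z = ((s - t) * norm (b - a)) *\<^sub>R d"
      unfolding st scaleR_scaleR[symmetric] d(2)[symmetric] by (simp add: algebra_simps)
    then show ?thesis ..
  qed
  have flat: "(y - z) \<bullet> \<mu> = 0" if "y \<in> e" "z \<in> e" "\<mu> = rot d \<or> \<mu> = - rot d" for y z \<mu>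
  proof -
    obtain t where "y - z = t *\<^sub>R d"
      using diff \<open>y \<in> e\<close> \<open>z \<in> e\<close> by blast
    then show ?thesis
      using \<open>\<mu> = rot d \<or> \<mu> = - rot d\<close> by (elim disjE) simp_all
  qed
  have nz: "rot d \<noteq> 0" using d(1) norm_rot[of d] by (metis norm_zero zero_neq_one)
  have "\<exists>\<nu>. (\<nu> = rot d \<or> \<nu> = - rot d) \<and> exits_along K \<nu> m"
    using edge_exits_along_dichotomy[OF cell e m nz flat] by blast
  then obtain \<nu> where \<nu>: "\<nu> = rot d \<or> \<nu> = - rot d" "exits_along K \<nu> m"
    by blast
  have "\<nu> \<noteq> 0" using \<nu>(1) nz by auto
  have norm: "norm \<nu> = 1" using \<nu>(1) d(1) by auto
  have flat\<nu>: "(y - z) \<bullet> \<nu> = 0" if "y \<in> e" "z \<in> e" for y z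
    using flat[OF that] \<nu>(1) by blast
  have exits: "exits_along K \<nu> x" if "x \<in> rel_interior e" for x
  proof (rule exits_along_propagates[OF _ m that \<nu>(2)])
    show "connected (rel_interior e)"
      by (simp add: ab convex_connected convex_rel_interior)
    show "(y - z) \<bullet> \<nu> = 0" if "y \<in> rel_interior e" "z \<in> rel_interior e" for y z
      using flat\<nu> that rel_interior_subset by blast
    show "exits_along K \<nu> z \<or> exits_along K (- \<nu>) z" if "z \<in> rel_interior e" for z
      using edge_exits_along_dichotomy[OF cell e that \<open>\<nu> \<noteq> 0\<close> flat\<nu>] by blast
  qed fact
  have "outward_normal K e = \<nu>"
    unfolding outward_normal_def
  proof (rule the_equality, intro conjI ballI)
    show "norm \<nu> = 1" by fact
    show "\<nu> \<bullet> (x - y) = 0" if "x \<in> e" "y \<in> e" for x y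
      using flat\<nu>[OF that] by (simp add: inner_commute)
    show "\<forall>\<^sub>F t in at_right 0. x + t *\<^sub>R \<nu> \<notin> K" if "x \<in> rel_interior e" for x
      using exits_along_eventually(1)[OF exits[OF that]] \<open>\<nu> \<noteq> 0\<close> by simp
  next
    \<comment> \<open>Uniqueness: orthogonality to e forces \<mu> to be \<nu> or its opposite, and
      the opposite leads into K at m.\<close>
    fix \<mu> assume \<mu>: "norm \<mu> = 1 \<and> (\<forall>x\<in>e. \<forall>y\<in>e. \<mu> \<bullet> (x - y) = 0) \<and>
     (\<forall>x\<in>rel_interior e. \<forall>\<^sub>F t in at_right 0. x + t *\<^sub>R \<mu> \<notin> K)"
    have "\<mu> \<bullet> (b - a) = 0"
      using \<mu> ab by auto
    then have "\<mu> \<bullet> d = 0"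
      by (simp add: d_def)
    then have 1: "\<mu> = (\<mu> \<bullet> rot d) *\<^sub>R rot d"
      using rot_decomp[OF d(1), of \<mu>] by simp
    then have "\<bar>\<mu> \<bullet> rot d\<bar> = 1"
      using \<mu> d(1) norm_scaleR[of "\<mu> \<bullet> rot d" "rot d"] by simp
    then have "\<mu> = \<nu> \<or> \<mu> = - \<nu>"
    proof -
      have "\<mu> \<bullet> rot d = 1 \<or> \<mu> \<bullet> rot d = - 1"
        using \<open>\<bar>\<mu> \<bullet> rot d\<bar> = 1\<close> by linarith
      then have "\<mu> = rot d \<or> \<mu> = - rot d"
        using 1 by (elim disjE) simp_all
      then show ?thesis using \<nu>(1) by auto
    qed
    moreover have "\<mu> \<noteq> - \<nu>"
    proof
      assume "\<mu> = - \<nu>"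
      then have "\<forall>\<^sub>F t in at_right 0. m + t *\<^sub>R \<mu> \<in> K"
        using exits_along_eventually(2)[OF \<nu>(2), of \<mu>] \<open>\<nu> \<noteq> 0\<close> by simp
      moreover have "\<forall>\<^sub>F t in at_right 0. m + t *\<^sub>R \<mu> \<notin> K"
        using \<mu> m by blast
      ultimately have "\<forall>\<^sub>F t in at_right (0::real). False"
        by eventually_elim simp
      then show False by simp
    qed
    ultimately show "\<mu> = \<nu>" by blast
  qed
  note * = this
  show "norm (outward_normal K e) = 1"
    using norm by (simp add: *)
  show "outward_normal K e \<bullet> (x - y) = 0" if "x \<in> e" "y \<in> e" for x y
    using flat\<nu>[OF that] by (simp add: * inner_commute)
  show "exits_along K (outward_normal K e) x" if "x \<in> rel_interior e" for x
    using exits[OF that] by (simp add: *)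
qed

section \<open>Closure of the boundary\<close>

text \<open>The hypothesis \<open>loc\<close> ignores the value at t itself, so h may deviate at
  isolated points. The function k of its punctured limits is locally constant, hence constant on the
  connected line, and it equals p and q far out.\<close>

lemma eventually_constant_limits_eq:
  fixes h :: "real \<Rightarrow> 'a"
  assumes loc: "\<And>t. \<exists>v. \<forall>\<^sub>F s in at t. h s = v"
    and top: "\<forall>\<^sub>F t in at_top. h t = p" and bot: "\<forall>\<^sub>F t in at_bot. h t = q"
  shows "p = q"
proof -
  obtain k where k: "\<And>t. \<forall>\<^sub>F s in at t. h s = k t"
    using loc by metis
  \<comment> \<open>Punctured neighbourhoods on the real line are nonempty, so two eventual values
    of h at s coincide.\<close>
  have eq: "k s = v" if "open U" "s \<in> U" "\<And>r. r \<in> U \<Longrightarrow> h r = v" for s U v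
  proof -
    have "\<forall>\<^sub>F r in at s. h r = v"
      unfolding eventually_at_topological using that by blast
    with k[of s] have "\<forall>\<^sub>F r in at s. k s = v"
      by eventually_elim simp
    then show ?thesis by simp
  qed
  have "k constant_on UNIV"
  proof (rule locally_constant_imp_constant)
    fix t
    obtain U where U: "open U" "t \<in> U" "\<And>s. s \<in> U \<Longrightarrow> s \<noteq> t \<Longrightarrow> h s = k t"
      using k[of t] unfolding eventually_at_topological by blast
    have "\<forall>s\<in>U. k s = k t"
    proof
      \<comment> \<open>For s distinct from t, the point t is removed from U because the value of h
        there is not controlled.\<close>
      fix s assume "s \<in> U"
      then show "k s = k t"
        using eq[of "U - {t}" s "k t"] U by (cases "s = t") (auto simp: open_Diff)
    qed
    moreover have "openin (top_of_set UNIV) U"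
      using U(1) by simp
    ultimately show "\<exists>T. openin (top_of_set UNIV) T \<and> t \<in> T \<and> (\<forall>x\<in>T. k x = k t)"
      using U(2) by blast
  qed simp
  moreover obtain N where N: "\<And>t. t \<ge> N \<Longrightarrow> h t = p"
    using top unfolding eventually_at_top_linorder by blast
  then have "k (N + 1) = p"
    by (intro eq[of "{N<..}"]) auto
  moreover obtain N' where N': "\<And>t. t \<le> N' \<Longrightarrow> h t = q"
    using bot unfolding eventually_at_bot_linorder by blast
  then have "k (N' - 1) = q"
    by (intro eq[of "{..<N'}"]) auto
  ultimately show "p = q"
    unfolding constant_on_def by auto
qed

lemma eventually_at_threshold:
  fixes t c :: real
  assumes "t \<noteq> c"
  shows "\<forall>\<^sub>F s in at t. (c < s) = (c < t)"
proof (cases "c < t")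
  case True
  then show ?thesis
    using order_tendstoD(1)[OF tendsto_ident_at, of c t UNIV] by (auto elim: eventually_mono)
next
  case False
  then show ?thesis
    using order_tendstoD(2)[OF tendsto_ident_at, of t c UNIV] assms by (auto elim: eventually_mono)
qed

lemma edge_endpoints:
  assumes "polygonal_cell K E" "e \<in> E"
  obtains a b where "a \<noteq> b" "e = closed_segment a b" "rel_interior e = open_segment a b"
    "e - rel_interior e = {a, b}"
proof -
  have "\<forall>e\<in>E. \<exists>a b. a \<noteq> b \<and> e = closed_segment a b"
    using assms unfolding polygonal_cell_def by auto
  then obtain a b where ab: "a \<noteq> b" "e = closed_segment a b"
    using assms by blast
  moreover have ri: "rel_interior e = open_segment a b"
    using ab by (simp add: rel_interior_closed_segment)
  moreover have "e - rel_interior e = {a, b}"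
    unfolding ri unfolding ab(2) open_segment_def by auto
  ultimately show thesis using that by blast
qed

text \<open>By \<open>generic\<close> the line contains no endpoint of an edge, so it crosses each
  edge of C transversally and once, and different edges at different parameters. The indicator of K
  drops to 0 where the normal has a positive component along d, rises to 1 where it has a negative
  one, and is 0 at both ends of the line.\<close>

lemma line_crossings_cancel:
  assumes cell: "polygonal_cell K E" and d: "norm d = 1"
    and generic: "\<And>e. e \<in> E \<Longrightarrow> s \<notin> (\<lambda>x. x \<bullet> rot d) ` (e - rel_interior e)"
  shows "(\<Sum>e | e \<in> E \<and> s \<in> (\<lambda>x. x \<bullet> rot d) ` e. sgn (outward_normal K e \<bullet> d)) = 0"
proof -
  define pt where "pt t = s *\<^sub>R rot d + t *\<^sub>R d" for t
  define C where "C = {e \<in> E. s \<in> (\<lambda>x. x \<bullet> rot d) ` e}"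
  define \<nu> where "\<nu> e = outward_normal K e" for e
  have E: "finite E" "pairwise (\<lambda>e e'. rel_interior e \<inter> e' = {}) E"
      "frontier K = \<Union>E" "compact K"
    using cell unfolding polygonal_cell_def by auto
  have dd: "d \<bullet> d = 1" using d by (simp add: norm_eq_1)
  have pt_rot: "pt t \<bullet> rot d = s" and pt_d: "pt t \<bullet> d = t" for t
    by (simp_all add: pt_def inner_add_left dd)
  have interior: "e \<in> C \<and> pt t \<in> rel_interior e" if "e \<in> E" "pt t \<in> e" for e t
    using that generic[OF that(1)] pt_rot[of t] by (force simp: C_def)
  have "\<exists>t. pt t \<in> rel_interior e" if eC: "e \<in> C" for e
  proof -
    obtain x where x: "x \<in> e" "s = x \<bullet> rot d" and "e \<in> E"
      using eC by (auto simp: C_def)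
    have "pt (x \<bullet> d) = x"
      using rot_decomp[OF d, of x] by (simp add: pt_def x(2))
    then show ?thesis using interior[OF \<open>e \<in> E\<close>, of "x \<bullet> d"] x(1) by metis
  qed
  then obtain \<tau> where \<tau>: "\<And>e. e \<in> C \<Longrightarrow> pt (\<tau> e) \<in> rel_interior e"
    by metis
  have CE: "e \<in> E" if "e \<in> C" for e using that by (simp add: C_def)
  have \<tau>e: "pt (\<tau> e) \<in> e" if "e \<in> C" for e
    using \<tau>[OF that] rel_interior_subset by blast
  \<comment> \<open>An edge parallel to d that meets the line would lie in it together with its
    endpoint a, against \<open>generic\<close>.\<close>
  have transversal: "\<nu> e \<bullet> d \<noteq> 0" if eC: "e \<in> C" for e
  proof
    assume 0: "\<nu> e \<bullet> d = 0"
    obtain a b where ab: "e - rel_interior e = {a, b}"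
      using edge_endpoints[OF cell CE[OF eC]] by metis
    have "\<nu> e \<bullet> (a - pt (\<tau> e)) = 0"
      unfolding \<nu>_def using outward_normal_props(2)[OF cell CE[OF eC]] \<tau>e[OF eC] ab by blast
    moreover have \<nu>eq: "\<nu> e = (\<nu> e \<bullet> rot d) *\<^sub>R rot d"
      using rot_decomp[OF d, of "\<nu> e"] 0 by simp
    moreover have "\<nu> e \<bullet> rot d \<noteq> 0"
      using \<nu>eq outward_normal_props(1)[OF cell CE[OF eC]] unfolding \<nu>_def
      by (metis norm_zero scaleR_zero_left zero_neq_one)
    ultimately have "rot d \<bullet> (a - pt (\<tau> e)) = 0"
      by (metis inner_scaleR_left mult_eq_0_iff)
    then have "a \<bullet> rot d = s"
      using pt_rot[of "\<tau> e"] by (simp add: inner_diff_right inner_commute)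
    then show False
      using generic[OF CE[OF eC]] ab by auto
  qed
  have unique: "t = \<tau> e" if "e \<in> C" "pt t \<in> e" for e t
  proof -
    have "\<nu> e \<bullet> (pt t - pt (\<tau> e)) = 0"
      unfolding \<nu>_def using outward_normal_props(2)[OF cell CE[OF that(1)]] \<tau>e that by blast
    then have "(t - \<tau> e) * (\<nu> e \<bullet> d) = 0"
      by (simp add: pt_def inner_diff_right inner_add_right algebra_simps)
    then show ?thesis using transversal[OF that(1)] by simp
  qed
  have \<tau>_inj: "\<tau> e' \<noteq> \<tau> e" if "e \<in> C" "e' \<in> C" "e' \<noteq> e" for e e'
  proof
    assume "\<tau> e' = \<tau> e"
    then have "pt (\<tau> e) \<in> rel_interior e' \<inter> e"
      using \<tau>[OF that(2)] \<tau>e[OF that(1)] by simp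
    then show False
      using E(2) CE[OF that(1)] CE[OF that(2)] that(3) unfolding pairwise_def by blast
  qed
  define g where "g t = (indicator K (pt t) :: real)" for t
  have exits: "exits_along K (\<nu> e) (pt (\<tau> e))" if "e \<in> C" for e
    unfolding \<nu>_def by (rule outward_normal_props(3)[OF cell CE[OF that] \<tau>[OF that]])
  have right: "\<forall>\<^sub>F t in at_right (\<tau> e). g t = (if \<nu> e \<bullet> d > 0 then 0 else 1)" if "e \<in> C" for e
    unfolding eventually_at_right_to_0[of _ "\<tau> e"]
    using exits_along_eventually[OF exits[OF that], of d] transversal[OF that]
    by (cases "\<nu> e \<bullet> d > 0")
      (auto simp: g_def pt_def inner_commute algebra_simps indicator_def elim!: eventually_mono)
  \<comment> \<open>Approaching from the left means leaving the crossing in direction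
    \<open>- d\<close>.\<close>
  have left: "\<forall>\<^sub>F t in at_left (\<tau> e). g t = (if \<nu> e \<bullet> d > 0 then 1 else 0)" if "e \<in> C" for e
    unfolding eventually_at_left_to_right eventually_at_right_to_0[of _ "- \<tau> e"]
    using exits_along_eventually[OF exits[OF that], of "- d"] transversal[OF that]
    by (cases "\<nu> e \<bullet> d > 0")
      (auto simp: g_def pt_def inner_commute algebra_simps indicator_def elim!: eventually_mono)
  define \<sigma> where "\<sigma> e = sgn (\<nu> e \<bullet> d)" for e
  \<comment> \<open>Adding a step at each crossing compensates the jumps of the indicator of \<open>K\<close>,
    so \<open>h\<close> is constant except for its values at the crossings.\<close>
  define h where "h t = g t + (\<Sum>e\<in>C. \<sigma> e * of_bool (\<tau> e < t))" for t
  have finC: "finite C" using E(1) by (simp add: C_def)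
  \<comment> \<open>Away from its threshold each step is locally constant; finiteness of D gives one
    neighbourhood for all of them.\<close>
  have steps: "\<forall>\<^sub>F r in at t. (\<Sum>e\<in>D. \<sigma> e * of_bool (\<tau> e < r)) = (\<Sum>e\<in>D. \<sigma> e * of_bool (\<tau> e < t))"
    if "finite D" "\<And>e. e \<in> D \<Longrightarrow> t \<noteq> \<tau> e" for D t
  proof -
    have "\<forall>\<^sub>F r in at t. \<forall>e\<in>D. (\<tau> e < r) = (\<tau> e < t)"
      using that by (intro eventually_ball_finite ballI eventually_at_threshold) auto
    then show ?thesis
      by eventually_elim (auto intro: sum.cong)
  qed
  have "\<exists>v. \<forall>\<^sub>F r in at t. h r = v" for t
  proof (cases "t \<in> \<tau> ` C")
    case True
    then obtain e where e: "e \<in> C" "t = \<tau> e" by blast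
    have split: "h r = (\<Sum>e\<in>C - {e}. \<sigma> e * of_bool (\<tau> e < r)) + (g r + \<sigma> e * of_bool (t < r))" for r
      unfolding h_def e(2) by (subst sum.remove[OF finC e(1)]) (simp only: ac_simps)
    \<comment> \<open>Both sides give the same value: 0 + 1 after and 1 + 0 before an exit, 1 - 1
      after and 0 + 0 before an entry.\<close>
    have "\<forall>\<^sub>F r in at_right t. g r + \<sigma> e * of_bool (t < r) = of_bool (\<nu> e \<bullet> d > 0)"
      using right[OF e(1)] eventually_at_right_less[of t] unfolding e(2)
      by eventually_elim (use transversal[OF e(1)] in \<open>auto simp: \<sigma>_def sgn_if\<close>)
    moreover have "\<forall>\<^sub>F r in at_left t. r < t"
      by (simp add: eventually_at_filter)
    then have "\<forall>\<^sub>F r in at_left t. g r + \<sigma> e * of_bool (t < r) = of_bool (\<nu> e \<bullet> d > 0)"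
      using left[OF e(1)] unfolding e(2) by eventually_elim auto
    ultimately have "\<forall>\<^sub>F r in at t. g r + \<sigma> e * of_bool (t < r) = of_bool (\<nu> e \<bullet> d > 0)"
      by (simp add: eventually_at_split)
    moreover have "\<forall>\<^sub>F r in at t. (\<Sum>e\<in>C - {e}. \<sigma> e * of_bool (\<tau> e < r))
        = (\<Sum>e\<in>C - {e}. \<sigma> e * of_bool (\<tau> e < t))"
      using finC \<tau>_inj[OF e(1)] e(2) by (intro steps) force+
    ultimately have "\<forall>\<^sub>F r in at t. h r =
        (\<Sum>e\<in>C - {e}. \<sigma> e * of_bool (\<tau> e < t)) + of_bool (\<nu> e \<bullet> d > 0)"
      unfolding split by eventually_elim simp
    then show ?thesis ..
  next
    case False
    \<comment> \<open>A frontier point on the line lies on an edge of C and so has parameter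
      \<open>\<tau> e\<close>; elsewhere the indicator is locally constant.\<close>
    then have "pt t \<notin> frontier K"
      using interior unique E(3) by blast
    then have "pt t \<in> interior K \<or> pt t \<in> - closure K"
      by (auto simp: frontier_def)
    moreover have lim: "(pt \<longlongrightarrow> pt t) (at t)"
      unfolding pt_def by (intro tendsto_intros)
    ultimately have "(\<forall>\<^sub>F r in at t. pt r \<in> interior K) \<or> (\<forall>\<^sub>F r in at t. pt r \<in> - closure K)"
      using topological_tendstoD[OF lim, of "interior K"]
        topological_tendstoD[OF lim, of "- closure K"] by (auto simp: open_Compl)
    then have "(\<forall>\<^sub>F r in at t. g r = 1) \<or> (\<forall>\<^sub>F r in at t. g r = 0)"
    proof
      assume "\<forall>\<^sub>F r in at t. pt r \<in> interior K"
      then have "\<forall>\<^sub>F r in at t. g r = 1"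
        by eventually_elim (use interior_subset[of K] in \<open>auto simp: g_def indicator_def\<close>)
      then show ?thesis ..
    next
      assume "\<forall>\<^sub>F r in at t. pt r \<in> - closure K"
      then have "\<forall>\<^sub>F r in at t. g r = 0"
        by eventually_elim (use closure_subset[of K] in \<open>auto simp: g_def indicator_def\<close>)
      then show ?thesis ..
    qed
    moreover have "\<forall>\<^sub>F r in at t. h r = v + (\<Sum>e\<in>C. \<sigma> e * of_bool (\<tau> e < t))"
      if "\<forall>\<^sub>F r in at t. g r = v" for v
    proof -
      have "\<forall>\<^sub>F r in at t. (\<Sum>e\<in>C. \<sigma> e * of_bool (\<tau> e < r)) = (\<Sum>e\<in>C. \<sigma> e * of_bool (\<tau> e < t))"
        using False by (intro steps finC) blast
      with that show ?thesis
        unfolding h_def by eventually_elim simp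
    qed
    ultimately show ?thesis by blast
  qed
  moreover obtain B where B: "\<And>x. x \<in> K \<Longrightarrow> norm x \<le> B"
    using compact_imp_bounded[OF E(4)] by (auto simp: bounded_iff)
  \<comment> \<open>Here t is the inner product of \<open>pt t\<close> with the unit vector d, so
    its absolute value is at most the norm of \<open>pt t\<close>.\<close>
  have g0: "g t = 0" if "\<bar>t\<bar> > B" for t
    using B[of "pt t"] Cauchy_Schwarz_ineq2[of "pt t" d] that
    by (auto simp: g_def pt_d d indicator_def)
  \<comment> \<open>Far to the right every step has been added, far to the left none.\<close>
  have "\<forall>\<^sub>F t in at_top. h t = sum \<sigma> C"
  proof -
    have "\<forall>\<^sub>F t in at_top. \<forall>e\<in>C. \<tau> e < t"
      using finC by (intro eventually_ball_finite ballI eventually_gt_at_top)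
    with eventually_gt_at_top[of B] show ?thesis
      by eventually_elim (simp add: h_def g0)
  qed
  moreover have "\<forall>\<^sub>F t in at_bot. h t = 0"
  proof -
    have "\<forall>\<^sub>F t in at_bot. \<forall>e\<in>C. t < \<tau> e"
      using finC by (intro eventually_ball_finite ballI eventually_gt_at_bot)
    with eventually_gt_at_bot[of "- B"] show ?thesis
      by eventually_elim (auto simp: h_def g0 intro!: sum.neutral)
  qed
  ultimately have "sum \<sigma> C = 0"
    by (rule eventually_constant_limits_eq)
  then show ?thesis by (simp add: \<sigma>_def \<nu>_def C_def)
qed

text \<open>The edge vector is c times \<open>rot \<nu>\<close>, and the quarter turn preserves
  inner products, so the projection has length
  \<open>\<bar>c\<bar> * \<bar>\<nu> \<bullet> d\<bar>\<close>. The factor \<open>sgn\<close>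
  restores the sign of \<open>\<nu> \<bullet> d\<close>.\<close>

lemma edge_projection:
  assumes cell: "polygonal_cell K E" and e: "e \<in> E" and d: "norm d = 1"
  shows "((\<lambda>s. sgn (outward_normal K e \<bullet> d) * indicator ((\<lambda>x. x \<bullet> rot d) ` e) s)
    has_integral edge_length e * (outward_normal K e \<bullet> d)) UNIV"
proof -
  define \<nu> where "\<nu> = outward_normal K e"
  obtain a b where ab: "e = closed_segment a b"
    using edge_endpoints[OF cell e] by metis
  have \<nu>: "norm \<nu> = 1" "\<nu> \<bullet> (b - a) = 0"
    unfolding \<nu>_def using outward_normal_props[OF cell e] ab by auto
  define c where "c = (b - a) \<bullet> rot \<nu>"
  have w: "b - a = c *\<^sub>R rot \<nu>"
    using rot_decomp[OF \<nu>(1), of "b - a"] \<nu>(2) by (simp add: c_def inner_commute)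
  then have "norm (b - a) = \<bar>c\<bar>"
    using \<nu>(1) by simp
  then have len: "edge_length e = \<bar>c\<bar>"
    by (simp add: edge_length_def ab diameter_closed_segment)
  define l u where "l = min (a \<bullet> rot d) (b \<bullet> rot d)" and "u = max (a \<bullet> rot d) (b \<bullet> rot d)"
  have "b \<bullet> rot d - a \<bullet> rot d = c * (\<nu> \<bullet> d)"
    using arg_cong[OF w, of "\<lambda>w. w \<bullet> rot d"] by (simp add: inner_diff_left)
  then have "\<bar>b \<bullet> rot d - a \<bullet> rot d\<bar> = \<bar>c\<bar> * \<bar>\<nu> \<bullet> d\<bar>"
    by (simp add: abs_mult)
  then have ul: "u - l = edge_length e * \<bar>\<nu> \<bullet> d\<bar>" "l \<le> u"
    unfolding len l_def u_def by linarith+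
  have "(\<lambda>x. x \<bullet> rot d) ` e = closed_segment (a \<bullet> rot d) (b \<bullet> rot d)"
    unfolding ab by (rule closed_segment_linear_image[symmetric])
      (intro bounded_linear.linear bounded_linear_inner_left)
  also have "\<dots> = {l..u}"
    by (auto simp: closed_segment_eq_real_ivl l_def u_def min_def max_def)
  finally have proj: "(\<lambda>x. x \<bullet> rot d) ` e = {l..u}" .
  have "((\<lambda>s. sgn (\<nu> \<bullet> d)) has_integral (u - l) * sgn (\<nu> \<bullet> d)) {l..u}"
    using has_integral_const_real[of "sgn (\<nu> \<bullet> d)" l u] ul(2) by simp
  then have "((\<lambda>s. if s \<in> {l..u} then sgn (\<nu> \<bullet> d) else 0) has_integral (u - l) * sgn (\<nu> \<bullet> d)) UNIV"
    by (simp only: has_integral_restrict_UNIV)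
  moreover have "(u - l) * sgn (\<nu> \<bullet> d) = edge_length e * (\<nu> \<bullet> d)"
    unfolding ul by (simp add: mult.assoc abs_mult_sgn)
  moreover have "(\<lambda>s. if s \<in> {l..u} then sgn (\<nu> \<bullet> d) else 0) = (\<lambda>s. sgn (\<nu> \<bullet> d) * indicator {l..u} s)"
    by (auto simp: fun_eq_iff indicator_def)
  ultimately show ?thesis
    unfolding proj by (simp add: \<nu>_def)
qed

text \<open>The signed count \<open>?f\<close> of the edges met by the line labelled s is integrated
  in two ways: edge by edge, and as a function that vanishes off the finite set \<open>?N\<close> of
  labels of lines through endpoints.\<close>

lemma sum_edge_length_inner_normal:
  assumes cell: "polygonal_cell K E" and d: "norm d = 1"
  shows "(\<Sum>e\<in>E. edge_length e * (outward_normal K e \<bullet> d)) = 0"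
proof -
  let ?f = "\<lambda>s. \<Sum>e\<in>E. sgn (outward_normal K e \<bullet> d) * indicator ((\<lambda>x. x \<bullet> rot d) ` e) s"
  let ?N = "(\<lambda>x. x \<bullet> rot d) ` (\<Union>e\<in>E. e - rel_interior e)"
  have "finite E"
    using cell unfolding polygonal_cell_def by auto
  have "(?f has_integral (\<Sum>e\<in>E. edge_length e * (outward_normal K e \<bullet> d))) UNIV"
    using edge_projection[OF cell _ d] by (intro has_integral_sum \<open>finite E\<close>)
  moreover have "(?f has_integral 0) UNIV"
  proof (rule has_integral_spike_finite[OF _ _ has_integral_0])
    have "finite (e - rel_interior e)" if "e \<in> E" for e
      using edge_endpoints[OF cell that] by (metis finite.emptyI finite.insertI)
    then show "finite ?N"
      using \<open>finite E\<close> by blast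
    fix s assume "s \<in> UNIV - ?N"
    then have "(\<Sum>e | e \<in> E \<and> s \<in> (\<lambda>x. x \<bullet> rot d) ` e. sgn (outward_normal K e \<bullet> d)) = 0"
      by (intro line_crossings_cancel[OF cell d]) blast
    also have "(\<Sum>e | e \<in> E \<and> s \<in> (\<lambda>x. x \<bullet> rot d) ` e. sgn (outward_normal K e \<bullet> d)) = ?f s"
      unfolding sum.inter_filter[OF \<open>finite E\<close>] by (intro sum.cong) (auto simp: indicator_def)
    finally show "?f s = 0" .
  qed
  ultimately show ?thesis
    by (rule has_integral_unique)
qed

text \<open>Unit directions suffice: in its own direction a nonzero sum would have its norm as
  component.\<close>

lemma sum_edge_length_normal:
  assumes "polygonal_cell K E"
  shows "(\<Sum>e\<in>E. edge_length e *\<^sub>R outward_normal K e) = 0"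
proof (rule ccontr)
  let ?v = "\<Sum>e\<in>E. edge_length e *\<^sub>R outward_normal K e"
  assume "?v \<noteq> 0"
  then have "norm (sgn ?v) = 1"
    by (simp add: norm_sgn)
  from sum_edge_length_inner_normal[OF assms this] have "?v \<bullet> sgn ?v = 0"
    by (simp add: inner_sum_left)
  with \<open>?v \<noteq> 0\<close> show False
    by (simp add: sgn_div_norm)
qed

section \<open>Steady states at rest\<close>

theorem proposition3p1:
  fixes \<Omega> :: "point set" and M :: mesh and P :: "'l::finite params"
    and H Hhat :: "nat \<Rightarrow> point set \<Rightarrow> real ^ 'l"
    and u :: "nat \<Rightarrow> point set \<Rightarrow> point ^ 'l"
    and n :: nat and c :: "'l \<Rightarrow> real"
  assumes mesh: "tessellation \<Omega> M"
    and params: "epsilon P > 0" "dt P > 0" "gamma P \<ge> 0" "alpha P \<ge> 0"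
    and mass_pos: "\<And>K i. K \<in> cells M \<Longrightarrow> H n K $ i > 0"
    and weight_nonneg: "\<And>K i. K \<in> cells M \<Longrightarrow> Hhat n K $ i \<ge> 0"
    and step: "scheme_step M P (Hhat n) (H n) (u n) (H (Suc n)) (u (Suc n))"
    and at_rest: "\<And>K i. K \<in> cells M \<Longrightarrow> u n K $ i = 0"
    and constant_potential: "\<And>K i. K \<in> cells M \<Longrightarrow> Phi P (H n) i K = c i"
  shows "\<forall>K\<in>cells M. \<forall>i.
           H (Suc n) K $ i = H n K $ i \<and>
           Phi P (H (Suc n)) i K = c i \<and>
           u (Suc n) K $ i = 0"
proof (intro ballI allI)
  fix K i assume K: "K \<in> cells M"
  \<comment> \<open>The hypotheses speak about cells only, so the neighbour must be known to be one
    before they apply across an edge.\<close>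
  have nb: "neighbour M K e \<in> cells M" if "e \<in> cell_edges M K" for e
  proof -
    have "\<exists>!K'. K' \<in> cells M \<and> K' \<noteq> K \<and> e \<in> cell_edges M K'"
      using mesh K that unfolding tessellation_def by simp
    from theI'[OF this] show ?thesis
      unfolding neighbour_def by blast
  qed
  have flux: "flux M P (Hhat n) (H n) (u n) j K e = 0" if "e \<in> cell_edges M K" for e j
    using K nb[OF that] by (simp add: flux_def edge_mean_def momentum_def Pi_edge_def edge_jump_def
        at_rest constant_potential)
  have Phi_star: "Phi_star M P (H n) (u n) i K e = c i" if "e \<in> cell_edges M K" for e
    using K nb[OF that] by (simp add: Phi_star_def edge_mean_def Lambda_edge_def
        edge_normal_jump_def momentum_def at_rest constant_potential)
  have cell: "polygonal_cell K (cell_edges M K)"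
    using mesh K unfolding tessellation_def by simp
  \<comment> \<open>All layers j at once, because the potential of layer i depends on the masses of
    every layer.\<close>
  have H: "H (Suc n) K $ j = H n K $ j" for j
    using step[unfolded scheme_step_def, rule_format, OF K, of j] by (simp add: flux)
  \<comment> \<open>The constant \<open>c i / (epsilon P)\<^sup>2\<close> comes out of the sum and
    leaves the closure of the boundary.\<close>
  have "(\<Sum>e\<in>cell_edges M K. (Phi_star M P (H n) (u n) i K e / (epsilon P)\<^sup>2 * edge_length e) *\<^sub>R
      outward_normal K e) = (c i / (epsilon P)\<^sup>2) *\<^sub>R
      (\<Sum>e\<in>cell_edges M K. edge_length e *\<^sub>R outward_normal K e)"
    unfolding scaleR_sum_right by (intro sum.cong) (simp_all add: Phi_star)
  also have "\<dots> = 0"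
    by (simp add: sum_edge_length_normal[OF cell])
  finally have pressure: "(\<Sum>e\<in>cell_edges M K.
      (Phi_star M P (H n) (u n) i K e / (epsilon P)\<^sup>2 * edge_length e) *\<^sub>R outward_normal K e) = 0" .
  \<comment> \<open>Only the momentum is seen to vanish here; the velocity follows because the new
    mass equals the old one, which is positive.\<close>
  have "H (Suc n) K $ i *\<^sub>R u (Suc n) K $ i = 0"
    using step[unfolded scheme_step_def, rule_format, OF K, of i] pressure
    by (auto simp: flux at_rest[OF K] pos_part_def neg_part_def)
  moreover have "H (Suc n) K $ i \<noteq> 0"
    using mass_pos[OF K, of i] by (simp add: H)
  moreover have "H (Suc n) K = H n K"
    by (simp add: vec_eq_iff H)
  then have "Phi P (H (Suc n)) i K = c i"
    using constant_potential[OF K, of i] by (simp add: Phi_def)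
  ultimately show "H (Suc n) K $ i = H n K $ i \<and> Phi P (H (Suc n)) i K = c i \<and> u (Suc n) K $ i = 0"
    by (simp add: H)
qed

end
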